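(* Let $\alpha\in(0,2)$ and let $u\in C^4(\mathbb{R})$ with $u$ and its derivatives up to order $4$ bounded. Let $(-\Delta_h)^{\alpha/2}_T$ and $(-\Delta_h)^{\alpha/2}_Q$ denote the discrete fractional Laplacian with, respectively, the weights $w_j=w^T_j$ (obtained from exact quadrature using linear interpolation) and $w_j=w^Q_j$ (obtained from exact quadrature using quadratic interpolation) defined in the context. Then the combined error of the finite difference scheme is $O(h^{2-\alpha})$ for linear interpolation and $O(h^{3-\alpha})$ for quadratic interpolation; that is, there is a constant $C$ depending only on $\alpha$ and $u$ such that for all $0<h<1$ and all $i\in\mathbb{Z}$, with $x_i=ih$ and $u_i=u(x_i)$, $$\big|(-\Delta)^{\alpha/2}u(x_i)-(-\Delta_h)^{\alpha/2}_T u_i\big|\le C h^{2-\alpha},\qquad \big|(-\Delta)^{\alpha/2}u(x_i)-(-\Delta_h)^{\alpha/2}_Q u_i\big|\le C h^{3-\alpha}.$$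
   Context: The fractional Laplacian in one dimension is $$(-\Delta)^{\alpha/2}u(x)=C_{1,\alpha}\,\mathrm{P.V.}\!\int_{\mathbb{R}}\frac{u(x)-u(x-y)}{|y|^{1+\alpha}}\,dy,\qquad C_{1,\alpha}=\frac{\alpha 2^{\alpha-1}\Gamma\left(\frac{\alpha+1}{2}\right)}{\pi^{1/2}\Gamma\left(\frac{2-\alpha}{2}\right)}.$$ For a grid function $(u_i)_{i\in\mathbb{Z}}$ with grid spacing $h>0$ (grid points $x_i=ih$) and symmetric weights $w_{-j}=w_j$, the discrete fractional Laplacian is $$(-\Delta_h)^{\alpha/2}u_i=\sum_{j=1}^{\infty}(2u_i-u_{i+j}-u_{i-j})\,w_j .$$ For $t>0$ define $$F(t)=\begin{cases}\frac{C_{1,\alpha}}{(\alpha-1)\alpha}t^{1-\alpha},&\alpha\neq1\\ -C_{1,\alpha}\log t,&\alpha=1,\end{cases}\qquad G(t)=\begin{cases}\frac{C_{1,\alpha}}{(2-\alpha)(\alpha-1)\alpha}t^{2-\alpha},&\alpha\neq1\\ C_{1,\alpha}(t-t\log t),&\alpha=1,\end{cases}$$ so that $F''(t)=G'''(t)=C_{1,\alpha}t^{-1-\alpha}$. The linear-interpolation weights are, for $j\ge1$ (with $w^T_{-j}=w^T_j$), $$w^T_1=h^{-\alpha}\Big[\tfrac{C_{1,\alpha}}{2-\alpha}-F'(1)+F(2)-F(1)\Big],\qquad w^T_j=h^{-\alpha}\big[F(j+1)-2F(j)+F(j-1)\big]\ (j\ge2).$$ The quadratic-interpolation weights are, for $j\ge1$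 (with $w^Q_{-j}=w^Q_j$), $$w^Q_1=h^{-\alpha}\Big[\tfrac{C_{1,\alpha}}{2-\alpha}-G''(1)-\tfrac{G'(3)+3G'(1)}{2}+G(3)-G(1)\Big],$$ $$w^Q_j=2h^{-\alpha}\big[G'(j+1)+G'(j-1)-G(j+1)+G(j-1)\big]\ (j\ge2\text{ even}),$$ $$w^Q_j=h^{-\alpha}\Big[-\tfrac{G'(j+2)+6G'(j)+G'(j-2)}{2}+G(j+2)-G(j-2)\Big]\ (j\ge3\text{ odd}).$$ *)

theory Defs
  imports "HOL-Analysis.Analysis"
begin

definition frac_const :: "real \<Rightarrow> real" where
  "frac_const \<alpha> =
     \<alpha> * 2 powr (\<alpha> - 1) * Gamma ((\<alpha> + 1) / 2) / (sqrt pi * Gamma ((2 - \<alpha>) / 2))"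

text \<open>The truncation is only at the singularity y = 0: for bounded u the integrand is
  absolutely integrable at infinity.\<close>

definition pv_integral :: "(real \<Rightarrow> real) \<Rightarrow> real" where
  "pv_integral f = Lim (at_right 0) (\<lambda>\<epsilon>. LINT y:{y. \<epsilon> < \<bar>y\<bar>}|lborel. f y)"

definition frac_laplacian :: "real \<Rightarrow> (real \<Rightarrow> real) \<Rightarrow> real \<Rightarrow> real" where
  "frac_laplacian \<alpha> u x =
     frac_const \<alpha> * pv_integral (\<lambda>y. (u x - u (x - y)) / \<bar>y\<bar> powr (1 + \<alpha>))"

text \<open>Only the weights with index at least 1 enter, so weights are functions on the naturals,
  the symmetric extension to negative indices is left implicit, and the value at 0 is irrelevant.
  The series is indexed from 0, hence the successors.\<close>

definition discrete_frac_laplacian :: "(nat \<Rightarrow> real) \<Rightarrow> (int \<Rightarrow> real) \<Rightarrow> int \<Rightarrow> real" where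
  "discrete_frac_laplacian w v i =
     (\<Sum>j. (2 * v i - v (i + int (Suc j)) - v (i - int (Suc j))) * w (Suc j))"

text \<open>The functions F and G below are meaningful for positive arguments only.\<close>

definition F :: "real \<Rightarrow> real \<Rightarrow> real" where
  "F \<alpha> t = (if \<alpha> \<noteq> 1 then frac_const \<alpha> / ((\<alpha> - 1) * \<alpha>) * t powr (1 - \<alpha>)
            else - frac_const \<alpha> * ln t)"

definition G :: "real \<Rightarrow> real \<Rightarrow> real" where
  "G \<alpha> t = (if \<alpha> \<noteq> 1 then frac_const \<alpha> / ((2 - \<alpha>) * (\<alpha> - 1) * \<alpha>) * t powr (2 - \<alpha>)
            else frac_const \<alpha> * (t - t * ln t))"

definition weight_T :: "real \<Rightarrow> real \<Rightarrow> nat \<Rightarrow> real" where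
  "weight_T \<alpha> h j =
     (if j = 1 then
        h powr (- \<alpha>) * (frac_const \<alpha> / (2 - \<alpha>) - deriv (F \<alpha>) 1 + F \<alpha> 2 - F \<alpha> 1)
      else
        h powr (- \<alpha>) * (F \<alpha> (real j + 1) - 2 * F \<alpha> (real j) + F \<alpha> (real j - 1)))"

definition weight_Q :: "real \<Rightarrow> real \<Rightarrow> nat \<Rightarrow> real" where
  "weight_Q \<alpha> h j =
     (if j = 1 then
        h powr (- \<alpha>) * (frac_const \<alpha> / (2 - \<alpha>) - deriv (deriv (G \<alpha>)) 1
          - (deriv (G \<alpha>) 3 + 3 * deriv (G \<alpha>) 1) / 2 + G \<alpha> 3 - G \<alpha> 1)
      else if even j then
        2 * h powr (- \<alpha>) * (deriv (G \<alpha>) (real j + 1) + deriv (G \<alpha>) (real j - 1)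
          - G \<alpha> (real j + 1) + G \<alpha> (real j - 1))
      else
        h powr (- \<alpha>) * (- (deriv (G \<alpha>) (real j + 2) + 6 * deriv (G \<alpha>) (real j)
          + deriv (G \<alpha>) (real j - 2)) / 2 + G \<alpha> (real j + 2) - G \<alpha> (real j - 2)))"

end

theory Submission
  imports Defs
begin

text \<open>Pairing \<^term>\<open>y\<close> with \<^term>\<open>- y\<close> turns the principal value into an absolutely convergent integral over
  the half line of the second difference of \<^term>\<open>u\<close> against the kernel, and rescaling by \<^term>\<open>h\<close> moves the
  grid to the integers. On the first cell the second difference is replaced by a multiple of
  \<^term>\<open>t\<^sup>2\<close>, on the others by its interpolant; integration by parts shows that the cellwise integrals
  regroup into the weights. Interpolation reproduces polynomials and is bounded, so Taylor's formula
  bounds the error on the cells by a power of \<^term>\<open>h\<close>, and the kernel has finite mass away from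
  the first cell.\<close>

subsection \<open>Integrals against the kernel\<close>

text \<open>The kernel is not integrable at 0, so on the first cell the model must vanish to second
  order. The second difference is even in the offset, hence quadratic to leading order:
  \<open>t\<^sup>2 * \<psi> 1\<close> has the right shape, misses by at most a multiple of
  \<open>h ^ 4 * t\<^sup>2\<close>, and its exact integral against the kernel supplies the summand
  \<open>frac_const \<alpha> / (2 - \<alpha>)\<close> of the first weight. In the rescaled variable
  the error is of order \<open>h ^ 4\<close> there and of order \<open>h\<^sup>2\<close> or
  \<open>h ^ 3\<close> on the other cells; the prefactor \<open>h powr (- \<alpha>)\<close> turns
  the latter into the stated rates. The delicate point is the order of summation. The discrete
  operator sums over nodes, the quadrature over cells, and a node shared by two cells collects a
  contribution from each. Partial sums over nodes therefore stop in the middle of a cell, and the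
  surplus must tend to 0. Its closed form contains terms that grow, so it is estimated by reading it
  back as an integral over a distant cell.\<close>

lemma F_has_derivative:
  assumes "0 < \<alpha>" "0 < t"
  shows "(F \<alpha> has_field_derivative - frac_const \<alpha> / \<alpha> * t powr (- \<alpha>)) (at t)"
proof (cases "\<alpha> = 1")
  case True
  have "((\<lambda>t. - frac_const \<alpha> * ln t) has_field_derivative - frac_const \<alpha> / \<alpha> * t powr (- \<alpha>)) (at t)"
    using assms True by (auto intro!: derivative_eq_intros simp: powr_minus divide_simps)
  then show ?thesis
    using True by (simp add: F_def[abs_def])
next
  case False
  have "((\<lambda>t. frac_const \<alpha> / ((\<alpha> - 1) * \<alpha>) * t powr (1 - \<alpha>)) has_field_derivative
      - frac_const \<alpha> / \<alpha> * t powr (- \<alpha>)) (at t)"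
    using assms False by (auto intro!: derivative_eq_intros simp: divide_simps) (simp add: algebra_simps)
  then show ?thesis
    using False by (simp add: F_def[abs_def])
qed

text \<open>With the derivatives of \<open>F\<close> and \<open>G\<close> known in closed form, the
  logarithmic case \<alpha> = 1 never has to be distinguished again.\<close>

lemma G_has_derivative:
  assumes "0 < \<alpha>" "\<alpha> < 2" "0 < t"
  shows "(G \<alpha> has_field_derivative F \<alpha> t) (at t)"
proof (cases "\<alpha> = 1")
  case True
  have "((\<lambda>t. frac_const \<alpha> * (t - t * ln t)) has_field_derivative F \<alpha> t) (at t)"
    using assms True by (auto intro!: derivative_eq_intros simp: F_def)
  then show ?thesis
    using True by (simp add: G_def[abs_def])
next
  case False
  have "((\<lambda>t. frac_const \<alpha> / ((2 - \<alpha>) * (\<alpha> - 1) * \<alpha>) * t powr (2 - \<alpha>)) has_field_derivative F \<alpha> t) (at t)"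
    using assms False by (auto intro!: derivative_eq_intros simp: F_def divide_simps)
  then show ?thesis
    using False by (simp add: G_def[abs_def])
qed

lemma deriv_F: "0 < \<alpha> \<Longrightarrow> 0 < t \<Longrightarrow> deriv (F \<alpha>) t = - frac_const \<alpha> / \<alpha> * t powr (- \<alpha>)"
  by (intro DERIV_imp_deriv F_has_derivative)

lemma deriv_G: "0 < \<alpha> \<Longrightarrow> \<alpha> < 2 \<Longrightarrow> 0 < t \<Longrightarrow> deriv (G \<alpha>) t = F \<alpha> t"
  by (intro DERIV_imp_deriv G_has_derivative)

text \<open>\<open>deriv (G \<alpha>)\<close> agrees with \<open>F \<alpha>\<close> only on the
  positive half line, so the derivative is transferred along that open set.\<close>

lemma deriv2_G:
  assumes "0 < \<alpha>" "\<alpha> < 2" "0 < t"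
  shows "deriv (deriv (G \<alpha>)) t = deriv (F \<alpha>) t"
proof -
  have "(deriv (G \<alpha>) has_field_derivative deriv (F \<alpha>) t) (at t)"
  proof (rule has_field_derivative_transform_within_open)
    show "(F \<alpha> has_field_derivative deriv (F \<alpha>) t) (at t)"
      using F_has_derivative[OF assms(1,3)] by (simp add: DERIV_imp_deriv)
  qed (use assms in \<open>auto simp: deriv_G intro: open_greaterThan[of 0]\<close>)
  then show ?thesis
    by (rule DERIV_imp_deriv)
qed

section \<open>The singular kernel and its iterated antiderivatives\<close>

definition kernel :: "real \<Rightarrow> real \<Rightarrow> real" where
  "kernel \<alpha> t = frac_const \<alpha> * t powr (- \<alpha> - 1)"

text \<open>Here \<open>q\<close> is the constant second derivative of \<open>p\<close>. Keeping
  \<open>deriv (F \<alpha>)\<close>, \<open>F \<alpha>\<close> and \<open>G \<alpha>\<close>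
  unevaluated makes the boundary values match the terms of the weights.\<close>

definition kernel_primitive :: "real \<Rightarrow> (real \<Rightarrow> real) \<Rightarrow> (real \<Rightarrow> real) \<Rightarrow> real \<Rightarrow> real \<Rightarrow> real" where
  "kernel_primitive \<alpha> p p' q t = p t * deriv (F \<alpha>) t - p' t * F \<alpha> t + q * G \<alpha> t"

text \<open>As \<^term>\<open>p\<close> is quadratic, integrating by parts three times against \<open>G''' = kernel\<close> leaves boundary terms only.\<close>

lemma kernel_has_integral:
  assumes \<alpha>: "0 < \<alpha>" "\<alpha> < 2" and ab: "0 < a" "a \<le> b"
    and p: "\<And>t. (p has_field_derivative p' t) (at t)"
    and p': "\<And>t. (p' has_field_derivative q) (at t)"
  shows "((\<lambda>t. p t * kernel \<alpha> t) has_integral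
    (kernel_primitive \<alpha> p p' q b - kernel_primitive \<alpha> p p' q a)) {a..b}"
proof -
  let ?H = "\<lambda>t. - frac_const \<alpha> / \<alpha> * t powr (- \<alpha>)"
  have H: "(?H has_field_derivative kernel \<alpha> t) (at t)" if "0 < t" for t
    using \<alpha> that by (auto intro!: derivative_eq_intros simp: kernel_def divide_simps algebra_simps)
  have "((\<lambda>t. p t * ?H t - p' t * F \<alpha> t + q * G \<alpha> t) has_field_derivative p t * kernel \<alpha> t) (at t)"
    if "0 < t" for t
    by (rule derivative_eq_intros p p' H F_has_derivative G_has_derivative \<alpha> that refl)+
       (simp add: algebra_simps)
  then have "((\<lambda>t. p t * kernel \<alpha> t) has_integral
      (p b * ?H b - p' b * F \<alpha> b + q * G \<alpha> b) - (p a * ?H a - p' a * F \<alpha> a + q * G \<alpha> a)) {a..b}"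
    using ab by (intro fundamental_theorem_of_calculus)
      (auto intro: has_field_derivative_at_within simp flip: has_real_derivative_iff_has_vector_derivative)
  then show ?thesis
    using \<alpha> ab by (simp add: kernel_primitive_def deriv_F)
qed

text \<open>The supremum of \<open>r\<close> is taken out and the mass of the kernel on the cell
  computed exactly; its difference form lets the cell bounds telescope later. Absolute values around
  \<open>frac_const \<alpha>\<close> make its sign irrelevant.\<close>

lemma kernel_integral_bound:
  assumes \<alpha>: "0 < \<alpha>" and ab: "0 < a" "a \<le> b"
    and r: "\<And>t. t \<in> {a..b} \<Longrightarrow> \<bar>r t\<bar> \<le> \<epsilon>"
    and I: "((\<lambda>t. r t * kernel \<alpha> t) has_integral I) {a..b}"
  shows "\<bar>I\<bar> \<le> \<epsilon> * \<bar>frac_const \<alpha>\<bar> / \<alpha> * (a powr (- \<alpha>) - b powr (- \<alpha>))"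
proof -
  have "((\<lambda>t. t powr (- \<alpha> - 1)) has_integral (- (b powr (- \<alpha>)) / \<alpha> - - (a powr (- \<alpha>)) / \<alpha>)) {a..b}"
  proof (rule fundamental_theorem_of_calculus)
    fix t assume "t \<in> {a..b}"
    then have "((\<lambda>t. - (t powr (- \<alpha>)) / \<alpha>) has_field_derivative t powr (- \<alpha> - 1)) (at t)"
      using \<alpha> ab by (auto intro!: derivative_eq_intros simp: divide_simps algebra_simps)
    then show "((\<lambda>t. - (t powr (- \<alpha>)) / \<alpha>) has_vector_derivative t powr (- \<alpha> - 1)) (at t within {a..b})"
      by (auto intro: has_field_derivative_at_within simp flip: has_real_derivative_iff_has_vector_derivative)
  qed (use ab in auto)
  from has_integral_mult_right[OF this, of "\<epsilon> * \<bar>frac_const \<alpha>\<bar>"]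
  have J: "((\<lambda>t. \<epsilon> * \<bar>frac_const \<alpha>\<bar> * t powr (- \<alpha> - 1)) has_integral
      \<epsilon> * \<bar>frac_const \<alpha>\<bar> / \<alpha> * (a powr (- \<alpha>) - b powr (- \<alpha>))) {a..b}"
    by (simp add: algebra_simps diff_divide_distrib)
  have "norm (integral {a..b} (\<lambda>t. r t * kernel \<alpha> t)) \<le> integral {a..b} (\<lambda>t. \<epsilon> * \<bar>frac_const \<alpha>\<bar> * t powr (- \<alpha> - 1))"
  proof (rule Henstock_Kurzweil_Integration.integral_norm_bound_integral
      [OF has_integral_integrable[OF I] has_integral_integrable[OF J]])
    fix t assume "t \<in> {a..b}"
    then show "norm (r t * kernel \<alpha> t) \<le> \<epsilon> * \<bar>frac_const \<alpha>\<bar> * t powr (- \<alpha> - 1)"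
      using r by (simp add: kernel_def abs_mult mult.assoc mult_right_mono)
  qed
  then show ?thesis
    by (simp only: integral_unique[OF I] integral_unique[OF J] real_norm_def)
qed

section \<open>From errors on single cells to the half line\<close>

lemma interpolation_integral_error:
  assumes \<alpha>: "0 < \<alpha>" and ab: "0 < a" "a \<le> b"
    and err: "\<And>t. t \<in> {a..b} \<Longrightarrow> \<bar>\<psi> t - p t\<bar> \<le> \<epsilon>"
    and p: "((\<lambda>t. p t * kernel \<alpha> t) has_integral I) {a..b}"
    and \<psi>: "(\<lambda>t. \<psi> t * kernel \<alpha> t) integrable_on {a..b}"
  shows "\<bar>integral {a..b} (\<lambda>t. \<psi> t * kernel \<alpha> t) - I\<bar>
    \<le> \<epsilon> * \<bar>frac_const \<alpha>\<bar> / \<alpha> * (a powr (- \<alpha>) - b powr (- \<alpha>))"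
proof -
  have "((\<lambda>t. (\<psi> t - p t) * kernel \<alpha> t) has_integral
      (integral {a..b} (\<lambda>t. \<psi> t * kernel \<alpha> t) - I)) {a..b}"
    using has_integral_diff[OF integrable_integral[OF \<psi>] p] by (simp add: left_diff_distrib)
  from kernel_integral_bound[OF \<alpha> ab err this] show ?thesis .
qed

text \<open>A uniform error bound would be useless next to the singularity. The factor
  \<open>t\<^sup>2\<close> lowers the singularity to \<open>t powr (1 - \<alpha>)\<close>, which has
  integral \<open>1 / (2 - \<alpha>)\<close> over the unit interval because \<alpha> < 2.\<close>

lemma first_interval_error:
  assumes \<alpha>: "0 < \<alpha>" "\<alpha> < 2"
    and err: "\<And>t. t \<in> {0..1} \<Longrightarrow> \<bar>\<psi> t - t\<^sup>2 * \<psi> 1\<bar> \<le> \<epsilon> * t\<^sup>2"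
    and \<psi>: "(\<lambda>t. \<psi> t * kernel \<alpha> t) integrable_on {0..1}"
  shows "\<bar>integral {0..1} (\<lambda>t. \<psi> t * kernel \<alpha> t) - \<psi> 1 * (frac_const \<alpha> / (2 - \<alpha>))\<bar>
    \<le> \<epsilon> * \<bar>frac_const \<alpha>\<bar> / (2 - \<alpha>)"
proof -
  \<comment> \<open>At 0 both sides vanish for every \<alpha>, since \<open>0 powr y = 0\<close>
    even for \<open>y = 0\<close>.\<close>
  have pow: "t\<^sup>2 * t powr (- \<alpha> - 1) = t powr (1 - \<alpha>)" if "0 \<le> t" for t :: real
  proof (cases "t = 0")
    case False
    then have "t\<^sup>2 = t powr 2" using that by (simp add: powr_numeral)
    then show ?thesis by (simp flip: powr_add)
  qed simp
  have J: "((\<lambda>t. t powr (1 - \<alpha>)) has_integral 1 / (2 - \<alpha>)) {0..1}"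
    using has_integral_powr_from_0[of "1 - \<alpha>" 1] \<alpha> by simp
  have P: "((\<lambda>t. t\<^sup>2 * \<psi> 1 * kernel \<alpha> t) has_integral \<psi> 1 * (frac_const \<alpha> / (2 - \<alpha>))) {0..1}"
  proof (rule has_integral_eq)
    show "((\<lambda>t. \<psi> 1 * frac_const \<alpha> * t powr (1 - \<alpha>)) has_integral \<psi> 1 * (frac_const \<alpha> / (2 - \<alpha>))) {0..1}"
      using has_integral_mult_right[OF J, of "\<psi> 1 * frac_const \<alpha>"] by simp
  qed (simp add: kernel_def flip: pow)
  have D: "((\<lambda>t. (\<psi> t - t\<^sup>2 * \<psi> 1) * kernel \<alpha> t) has_integral
      (integral {0..1} (\<lambda>t. \<psi> t * kernel \<alpha> t) - \<psi> 1 * (frac_const \<alpha> / (2 - \<alpha>)))) {0..1}"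
    using has_integral_diff[OF integrable_integral[OF \<psi>] P] by (simp add: left_diff_distrib)
  have B: "((\<lambda>t. \<epsilon> * t\<^sup>2 * (\<bar>frac_const \<alpha>\<bar> * t powr (- \<alpha> - 1))) has_integral \<epsilon> * \<bar>frac_const \<alpha>\<bar> / (2 - \<alpha>)) {0..1}"
  proof (rule has_integral_eq)
    show "((\<lambda>t. \<epsilon> * \<bar>frac_const \<alpha>\<bar> * t powr (1 - \<alpha>)) has_integral \<epsilon> * \<bar>frac_const \<alpha>\<bar> / (2 - \<alpha>)) {0..1}"
      using has_integral_mult_right[OF J, of "\<epsilon> * \<bar>frac_const \<alpha>\<bar>"] by simp
  qed (simp flip: pow)
  have "norm (integral {0..1} (\<lambda>t. (\<psi> t - t\<^sup>2 * \<psi> 1) * kernel \<alpha> t))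
      \<le> integral {0..1} (\<lambda>t. \<epsilon> * t\<^sup>2 * (\<bar>frac_const \<alpha>\<bar> * t powr (- \<alpha> - 1)))"
  proof (rule Henstock_Kurzweil_Integration.integral_norm_bound_integral
      [OF has_integral_integrable[OF D] has_integral_integrable[OF B]])
    fix t :: real assume "t \<in> {0..1}"
    then show "norm ((\<psi> t - t\<^sup>2 * \<psi> 1) * kernel \<alpha> t)
        \<le> \<epsilon> * t\<^sup>2 * (\<bar>frac_const \<alpha>\<bar> * t powr (- \<alpha> - 1))"
      using err by (simp add: kernel_def abs_mult mult_right_mono)
  qed
  then show ?thesis
    using D B by (simp add: integral_unique)
qed

text \<open>Convergence of \<open>Q\<close> is a conclusion: the cell integrals form a convergent
  series by integrability of \<open>g\<close>, and \<open>Q\<close> differs from them by an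
  absolutely convergent one.\<close>

lemma quadrature_series:
  fixes g :: "real \<Rightarrow> real" and p Q e :: "nat \<Rightarrow> real"
  assumes g: "set_integrable lborel {0..} g"
    and p: "p 0 = 0" "mono p" "filterlim p at_top sequentially"
    and err: "\<And>k. \<bar>integral {p k..p (Suc k)} g - Q k\<bar> \<le> e k"
    and e: "e sums E"
  obtains s where "Q sums s" "\<bar>integral {0..} g - s\<bar> \<le> E"
proof -
  have int: "set_integrable lborel {a..b} g" if "0 \<le> a" for a b
    by (rule set_integrable_subset[OF g]) (use that in auto)
  have p0: "0 \<le> p k" for k
    using monoD[OF p(2), of 0 k] p(1) by simp
  have part: "(\<Sum>k<n. integral {p k..p (Suc k)} g) = integral {0..p n} g" for n
  proof (induction n)
    case (Suc n)
    have "integral {0..p n} g + integral {p n..p (Suc n)} g = integral {0..p (Suc n)} g"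
      by (rule Henstock_Kurzweil_Integration.integral_combine)
         (use p0 monoD[OF p(2), of n "Suc n"] set_borel_integral_eq_integral(1)[OF int] in auto)
    with Suc show ?case by simp
  qed (simp add: p)
  have Un: "(\<Union>n. {0..p n}) = {0..}"
  proof safe
    fix t :: real assume "0 \<le> t"
    have "\<forall>\<^sub>F n in sequentially. t \<le> p n"
      using p(3) by (simp add: filterlim_at_top)
    then show "t \<in> (\<Union>n. {0..p n})"
      using \<open>0 \<le> t\<close> by (auto simp: eventually_sequentially)
  qed auto
  have "(\<lambda>n. set_lebesgue_integral lborel {0..p n} g) \<longlonglongrightarrow> set_lebesgue_integral lborel (\<Union>n. {0..p n}) g"
    by (rule set_integral_cont_up) (use p(2) g Un in \<open>auto simp: incseq_def mono_def intro: order_trans\<close>)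
  then have "(\<lambda>n. integral {0..p n} g) \<longlonglongrightarrow> integral {0..} g"
    by (simp add: Un set_borel_integral_eq_integral(2) int g)
  then have J: "(\<lambda>k. integral {p k..p (Suc k)} g) sums integral {0..} g"
    by (simp add: sums_def part)
  let ?d = "\<lambda>k. integral {p k..p (Suc k)} g - Q k"
  have d: "summable (\<lambda>k. norm (?d k))"
    by (rule summable_comparison_test[OF _ sums_summable[OF e]]) (use err in auto)
  have "Q sums (integral {0..} g - suminf ?d)"
    using sums_diff[OF J summable_sums[OF summable_norm_cancel[OF d]]] by simp
  moreover have "\<bar>suminf ?d\<bar> \<le> E"
    using summable_norm[OF d] suminf_le[OF _ d sums_summable[OF e]] err sums_unique[OF e] by fastforce
  ultimately show ?thesis
    using that by fastforce
qed

text \<open>The summands of \<open>kernel_primitive\<close> cannot be bounded separately, as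
  \<open>G\<close> grows at infinity. Their cancellation becomes visible only when the difference is
  read as an integral over the cell.\<close>

lemma kernel_primitive_bound:
  assumes \<alpha>: "0 < \<alpha>" "\<alpha> < 2" and ab: "0 < a" "a \<le> b"
    and p: "\<And>t. (p has_field_derivative p' t) (at t)"
    and p': "\<And>t. (p' has_field_derivative q) (at t)"
    and bound: "\<And>t. t \<in> {a..b} \<Longrightarrow> \<bar>p t\<bar> \<le> 1"
  shows "\<bar>kernel_primitive \<alpha> p p' q b - kernel_primitive \<alpha> p p' q a\<bar>
    \<le> \<bar>frac_const \<alpha>\<bar> / \<alpha> * (a powr (- \<alpha>) - b powr (- \<alpha>))"
  using kernel_integral_bound[OF \<alpha>(1) ab bound kernel_has_integral[OF \<alpha> ab p p']] by simp

text \<open>This disposes of the surplus left when a sum over nodes stops inside a cell: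
  \<open>c n\<close> stands for a node value, \<open>p n\<close> for its basis polynomial, and the
  cell starting at \<open>x n\<close> moves off to infinity.\<close>

lemma tendsto_kernel_primitive_diff:
  fixes p p' :: "nat \<Rightarrow> real \<Rightarrow> real" and q x :: "nat \<Rightarrow> real"
  assumes \<alpha>: "0 < \<alpha>" "\<alpha> < 2" and x: "\<And>n. 0 < x n" "filterlim x at_top sequentially"
    and d: "0 \<le> d"
    and p: "\<And>n t. (p n has_field_derivative p' n t) (at t)"
    and p': "\<And>n t. (p' n has_field_derivative q n) (at t)"
    and bound: "\<And>n t. t \<in> {x n..x n + d} \<Longrightarrow> \<bar>p n t\<bar> \<le> 1"
    and c: "\<And>n. \<bar>c n\<bar> \<le> M"
  shows "(\<lambda>n. c n * (kernel_primitive \<alpha> (p n) (p' n) (q n) (x n + d)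
      - kernel_primitive \<alpha> (p n) (p' n) (q n) (x n))) \<longlonglongrightarrow> 0"
proof (rule Lim_null_comparison)
  show "(\<lambda>n. M * (\<bar>frac_const \<alpha>\<bar> / \<alpha> * x n powr (- \<alpha>))) \<longlonglongrightarrow> 0"
    by (rule tendsto_eq_intros tendsto_neg_powr x | use \<alpha> in simp)+
  show "\<forall>\<^sub>F n in sequentially. norm (c n * (kernel_primitive \<alpha> (p n) (p' n) (q n) (x n + d)
      - kernel_primitive \<alpha> (p n) (p' n) (q n) (x n))) \<le> M * (\<bar>frac_const \<alpha>\<bar> / \<alpha> * x n powr (- \<alpha>))"
  proof (intro always_eventually allI)
    fix n
    have "\<bar>kernel_primitive \<alpha> (p n) (p' n) (q n) (x n + d) - kernel_primitive \<alpha> (p n) (p' n) (q n) (x n)\<bar>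
      \<le> \<bar>frac_const \<alpha>\<bar> / \<alpha> * (x n powr (- \<alpha>) - (x n + d) powr (- \<alpha>))"
      by (rule kernel_primitive_bound) (use assms in auto)
    also have "\<dots> \<le> \<bar>frac_const \<alpha>\<bar> / \<alpha> * x n powr (- \<alpha>)"
      using \<alpha> by (intro mult_left_mono) auto
    finally show "norm (c n * (kernel_primitive \<alpha> (p n) (p' n) (q n) (x n + d)
        - kernel_primitive \<alpha> (p n) (p' n) (q n) (x n))) \<le> M * (\<bar>frac_const \<alpha>\<bar> / \<alpha> * x n powr (- \<alpha>))"
      unfolding real_norm_def abs_mult by (rule mult_mono[OF c]) (use order_trans[OF abs_ge_zero c[of 0]] in auto)
  qed
qed

text \<open>The breakpoints \<open>p\<close> stay abstract so that the unit cells of the linear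
  scheme and the double cells of the quadratic scheme are both covered. Cell 0 is always the unit
  interval at the singularity.\<close>

lemma quadrature_error_series:
  fixes \<psi> :: "real \<Rightarrow> real" and p Q :: "nat \<Rightarrow> real"
  assumes \<alpha>: "0 < \<alpha>" "\<alpha> < 2"
    and int: "set_integrable lborel {0..} (\<lambda>t. \<psi> t * kernel \<alpha> t)"
    and p: "p 0 = 0" "p 1 = 1" "mono p" "filterlim p at_top sequentially"
    and Q0: "Q 0 = \<psi> 1 * (frac_const \<alpha> / (2 - \<alpha>))"
    and near: "\<And>t. t \<in> {0..1} \<Longrightarrow> \<bar>\<psi> t - t\<^sup>2 * \<psi> 1\<bar> \<le> \<epsilon>0 * t\<^sup>2"
    and far: "\<And>k t. k \<ge> 1 \<Longrightarrow> t \<in> {p k..p (Suc k)} \<Longrightarrow> \<bar>\<psi> t - P k t\<bar> \<le> \<epsilon>"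
    and P: "\<And>k. k \<ge> 1 \<Longrightarrow> ((\<lambda>t. P k t * kernel \<alpha> t) has_integral Q k) {p k..p (Suc k)}"
  obtains s where "Q sums s"
    "\<bar>integral {0..} (\<lambda>t. \<psi> t * kernel \<alpha> t) - s\<bar>
      \<le> \<epsilon>0 * \<bar>frac_const \<alpha>\<bar> / (2 - \<alpha>) + \<epsilon> * \<bar>frac_const \<alpha>\<bar> / \<alpha>"
proof -
  let ?g = "\<lambda>t. \<psi> t * kernel \<alpha> t"
  have p1: "1 \<le> p k" if "k \<ge> 1" for k
    using monoD[OF p(3) that] p(2) by simp
  have p0: "0 \<le> p k" for k
    using monoD[OF p(3), of 0 k] p(1) by simp
  have integrable: "?g integrable_on {p k..p (Suc k)}" for k
    by (rule set_borel_integral_eq_integral(1), rule set_integrable_subset[OF int]) (use p0[of k] in auto)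
  define e where "e k = (if k = 0 then \<epsilon>0 * \<bar>frac_const \<alpha>\<bar> / (2 - \<alpha>)
    else \<epsilon> * \<bar>frac_const \<alpha>\<bar> / \<alpha> * (p k powr (- \<alpha>) - p (Suc k) powr (- \<alpha>)))" for k
  have err: "\<bar>integral {p k..p (Suc k)} ?g - Q k\<bar> \<le> e k" for k
  proof (cases "k = 0")
    case True
    then show ?thesis
      using first_interval_error[OF \<alpha> near] integrable[of 0] by (simp add: e_def p Q0 flip: One_nat_def)
  next
    case False
    then show ?thesis
      using interpolation_integral_error[OF \<alpha>(1) _ _ far P integrable, of k] p1[of k] monoD[OF p(3), of k "Suc k"]
      by (simp add: e_def)
  qed
  have "(\<lambda>k. p (Suc k) powr (- \<alpha>)) \<longlonglongrightarrow> 0"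
    by (rule tendsto_neg_powr) (use \<alpha> filterlim_compose[OF p(4) filterlim_Suc] in auto)
  \<comment> \<open>The bounds telescope from \<open>p 1 = 1\<close> to infinity, leaving the full
    mass \<open>1 / \<alpha>\<close> of \<open>t powr (- \<alpha> - 1)\<close> beyond 1.\<close>
  from sums_mult[OF telescope_sums'[OF this], of "\<epsilon> * \<bar>frac_const \<alpha>\<bar> / \<alpha>"]
  have "(\<lambda>k. e (Suc k)) sums (\<epsilon> * \<bar>frac_const \<alpha>\<bar> / \<alpha>)"
    by (simp add: e_def p flip: One_nat_def)
  then have "e sums (\<epsilon>0 * \<bar>frac_const \<alpha>\<bar> / (2 - \<alpha>) + \<epsilon> * \<bar>frac_const \<alpha>\<bar> / \<alpha>)"
    using sums_Suc_iff[of e] by (simp add: e_def add.commute)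
  from quadrature_series[OF int p(1,3,4) err this] that show ?thesis
    by blast
qed

text \<open>Needed because node sums of the quadratic scheme end at a shared node or at a cell
  midpoint according to parity.\<close>

lemma LIMSEQ_even_odd:
  fixes f :: "nat \<Rightarrow> 'a::topological_space"
  assumes "(\<lambda>n. f (2 * n)) \<longlonglongrightarrow> l" "(\<lambda>n. f (2 * n + 1)) \<longlonglongrightarrow> l"
  shows "f \<longlonglongrightarrow> l"
proof (rule topological_tendstoI)
  fix S assume "open S" "l \<in> S"
  then obtain N1 N2 where N: "\<And>n. n \<ge> N1 \<Longrightarrow> f (2 * n) \<in> S" "\<And>n. n \<ge> N2 \<Longrightarrow> f (2 * n + 1) \<in> S"
    using assms[THEN topological_tendstoD] unfolding eventually_sequentially by metis
  have "f n \<in> S" if "n \<ge> 2 * (N1 + N2) + 1" for n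
    using N(1)[of "n div 2"] N(2)[of "n div 2"] that by (cases "even n") (auto elim!: oddE)
  then show "\<forall>\<^sub>F n in sequentially. f n \<in> S"
    unfolding eventually_sequentially by blast
qed

subsection \<open>Regrouping cellwise quadrature into weights\<close>

text \<open>Node \<open>j\<close> is the right end of cell \<open>j - 1\<close> and the left end of
  cell \<open>j\<close>, so its weight joins \<open>b (j - 1)\<close> and \<open>a j\<close>. The
  first \<open>n\<close> nodes thus account for cells 0 to \<open>n - 1\<close> and for the left
  half \<open>a n\<close> of the next.\<close>

lemma linear_scheme_error:
  fixes \<psi> :: "real \<Rightarrow> real"
  assumes \<alpha>: "0 < \<alpha>" "\<alpha> < 2"
    and int: "set_integrable lborel {0..} (\<lambda>t. \<psi> t * kernel \<alpha> t)"
    and \<psi>: "\<psi> 0 = 0" "\<And>t. \<bar>\<psi> t\<bar> \<le> M"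
    and near: "\<And>t. t \<in> {0..1} \<Longrightarrow> \<bar>\<psi> t - t\<^sup>2 * \<psi> 1\<bar> \<le> \<epsilon>0 * t\<^sup>2"
    and far: "\<And>k t. t \<in> {real k..real k + 1} \<Longrightarrow>
      \<bar>\<psi> t - (\<psi> k * (k + 1 - t) + \<psi> (k + 1) * (t - k))\<bar> \<le> \<epsilon>"
  obtains s where "(\<lambda>j. \<psi> (real (Suc j)) * weight_T \<alpha> h (Suc j)) sums (h powr (- \<alpha>) * s)"
    "\<bar>integral {0..} (\<lambda>t. \<psi> t * kernel \<alpha> t) - s\<bar>
      \<le> \<epsilon>0 * \<bar>frac_const \<alpha>\<bar> / (2 - \<alpha>) + \<epsilon> * \<bar>frac_const \<alpha>\<bar> / \<alpha>"
proof -
  define KP where "KP p p' k = kernel_primitive \<alpha> p p' 0 (real k + 1) - kernel_primitive \<alpha> p p' 0 (real k)"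
    for p p' :: "real \<Rightarrow> real" and k :: nat
  \<comment> \<open>The values at index 0 encode the cell containing the singularity, so that every weight is \<open>a (Suc j) + b j\<close>.\<close>
  define a where "a k = (if k = 0 then 0 else KP (\<lambda>t. k + 1 - t) (\<lambda>_. -1) k)" for k :: nat
  define b where "b k = (if k = 0 then frac_const \<alpha> / (2 - \<alpha>) else KP (\<lambda>t. t - k) (\<lambda>_. 1) k)" for k :: nat
  define Q where "Q k = \<psi> (real k) * a k + \<psi> (real (Suc k)) * b k" for k
  have a_int: "((\<lambda>t. (k + 1 - t) * kernel \<alpha> t) has_integral a k) {real k..real k + 1}" if "k \<ge> 1" for k :: nat
  proof -
    have "((\<lambda>t. k + 1 - t) has_field_derivative -1) (at t)" for t :: real
      by (auto intro!: derivative_eq_intros)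
    from kernel_has_integral[OF \<alpha> _ _ this, of "real k" "real k + 1" 0] that show ?thesis
      by (simp add: a_def KP_def)
  qed
  have b_int: "((\<lambda>t. (t - k) * kernel \<alpha> t) has_integral b k) {real k..real k + 1}" if "k \<ge> 1" for k :: nat
  proof -
    have "((\<lambda>t. t - k) has_field_derivative 1) (at t)" for t :: real
      by (auto intro!: derivative_eq_intros)
    from kernel_has_integral[OF \<alpha> _ _ this, of "real k" "real k + 1" 0] that show ?thesis
      by (simp add: b_def KP_def)
  qed
  \<comment> \<open>The terms with \<open>deriv (F \<alpha>)\<close> from the two neighbouring cells
    cancel. At node 1 the left neighbour is the singular cell, which has no such term, so
    \<open>- deriv (F \<alpha>) 1\<close> survives.\<close>
  have w: "weight_T \<alpha> h (Suc j) = h powr (- \<alpha>) * (a (Suc j) + b j)" for j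
    by (cases "j = 0") (auto simp: weight_T_def a_def b_def KP_def kernel_primitive_def algebra_simps)
  have part: "(\<Sum>j<n. \<psi> (real (Suc j)) * weight_T \<alpha> h (Suc j))
    = h powr (- \<alpha>) * ((\<Sum>k<n. Q k) + \<psi> n * a n)" for n
  proof (induction n)
    case (Suc n)
    then show ?case by (simp add: w Q_def algebra_simps)
  qed (simp add: a_def)
  have "(\<lambda>n. \<psi> (real (Suc n)) * a (Suc n)) \<longlonglongrightarrow> 0"
  proof -
    have "filterlim (\<lambda>n. real (Suc n)) at_top sequentially"
      by (rule filterlim_compose[OF filterlim_real_sequentially filterlim_Suc])
    moreover have "((\<lambda>t. real (Suc n) + 1 - t) has_field_derivative -1) (at t)" for n and t :: real
      by (auto intro!: derivative_eq_intros)
    ultimately show ?thesis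
      using tendsto_kernel_primitive_diff[OF \<alpha>, of "\<lambda>n. real (Suc n)" 1 "\<lambda>n t. real (Suc n) + 1 - t" "\<lambda>_ _. -1" "\<lambda>_. 0"
        "\<lambda>n. \<psi> (real (Suc n))" M] \<psi>(2) by (simp add: a_def KP_def)
  qed
  then have a_lim: "(\<lambda>n. \<psi> (real n) * a n) \<longlonglongrightarrow> 0"
    by (rule LIMSEQ_imp_Suc)
  have P: "((\<lambda>t. (\<psi> k * (k + 1 - t) + \<psi> (k + 1) * (t - k)) * kernel \<alpha> t) has_integral Q k) {real k..real (Suc k)}"
    if "k \<ge> 1" for k :: nat
    using has_integral_add[OF has_integral_mult_right[OF a_int[OF that], of "\<psi> k"]
        has_integral_mult_right[OF b_int[OF that], of "\<psi> (k + 1)"]]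
    by (simp add: Q_def algebra_simps)
  obtain s where s: "Q sums s" "\<bar>integral {0..} (\<lambda>t. \<psi> t * kernel \<alpha> t) - s\<bar>
      \<le> \<epsilon>0 * \<bar>frac_const \<alpha>\<bar> / (2 - \<alpha>) + \<epsilon> * \<bar>frac_const \<alpha>\<bar> / \<alpha>"
    by (rule quadrature_error_series[OF \<alpha> int, of real Q \<epsilon>0
        "\<lambda>k t. \<psi> k * (k + 1 - t) + \<psi> (k + 1) * (t - k)" \<epsilon>])
       (use near far P in \<open>auto simp: mono_def filterlim_real_sequentially Q_def b_def \<psi> add.commute\<close>)
  have "(\<lambda>j. \<psi> (real (Suc j)) * weight_T \<alpha> h (Suc j)) sums (h powr (- \<alpha>) * s)"
    unfolding sums_def part
    using tendsto_mult[OF tendsto_const tendsto_add[OF s(1)[unfolded sums_def] a_lim]] by simp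
  with s(2) that show ?thesis by blast
qed

text \<open>These are the Lagrange basis polynomials for the nodes \<open>c - 1\<close>,
  \<open>c\<close>, \<open>c + 1\<close>. The bounds serve both the vanishing of the surplus and the
  stability of interpolation.\<close>

lemma quadratic_basis_bounds:
  fixes c t :: real
  assumes "t \<in> {c - 1..c + 1}"
  shows "\<bar>(t - c) * (t - c - 1) / 2\<bar> \<le> 1" "\<bar>1 - (t - c)\<^sup>2\<bar> \<le> 1" "\<bar>(t - c) * (t - c + 1) / 2\<bar> \<le> 1"
proof -
  have s: "\<bar>t - c\<bar> \<le> 1"
    using assms by auto
  show "\<bar>(t - c) * (t - c - 1) / 2\<bar> \<le> 1"
    using mult_mono[OF s, of "\<bar>t - c - 1\<bar>" 2] s by (auto simp: abs_mult)
  show "\<bar>(t - c) * (t - c + 1) / 2\<bar> \<le> 1"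
    using mult_mono[OF s, of "\<bar>t - c + 1\<bar>" 2] s by (auto simp: abs_mult)
  show "\<bar>1 - (t - c)\<^sup>2\<bar> \<le> 1"
    using s abs_square_le_1[of "t - c"] by simp
qed

text \<open>Cells have length 2 and are centred at the even nodes \<open>2 * k\<close>. An even node
  lies in one cell only, an odd node is shared by two, whence the two kinds of weights.\<close>

lemma quadratic_scheme_error:
  fixes \<psi> :: "real \<Rightarrow> real"
  assumes \<alpha>: "0 < \<alpha>" "\<alpha> < 2"
    and int: "set_integrable lborel {0..} (\<lambda>t. \<psi> t * kernel \<alpha> t)"
    and \<psi>: "\<And>t. \<bar>\<psi> t\<bar> \<le> M"
    and near: "\<And>t. t \<in> {0..1} \<Longrightarrow> \<bar>\<psi> t - t\<^sup>2 * \<psi> 1\<bar> \<le> \<epsilon>0 * t\<^sup>2"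
    and far: "\<And>c t. t \<in> {c - 1..c + 1} \<Longrightarrow>
      \<bar>\<psi> t - (\<psi> (c - 1) * ((t - c) * (t - c - 1) / 2) + \<psi> c * (1 - (t - c)\<^sup>2)
        + \<psi> (c + 1) * ((t - c) * (t - c + 1) / 2))\<bar> \<le> \<epsilon>"
  obtains s where "(\<lambda>j. \<psi> (real (Suc j)) * weight_Q \<alpha> h (Suc j)) sums (h powr (- \<alpha>) * s)"
    "\<bar>integral {0..} (\<lambda>t. \<psi> t * kernel \<alpha> t) - s\<bar>
      \<le> \<epsilon>0 * \<bar>frac_const \<alpha>\<bar> / (2 - \<alpha>) + \<epsilon> * \<bar>frac_const \<alpha>\<bar> / \<alpha>"
proof -
  define KP where "KP p p' q k = kernel_primitive \<alpha> p p' q (real (2 * k) + 1) - kernel_primitive \<alpha> p p' q (real (2 * k) - 1)"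
    for p p' :: "real \<Rightarrow> real" and q :: real and k :: nat
  define pa pb pd :: "real \<Rightarrow> real \<Rightarrow> real" where "pa c t = (t - c) * (t - c - 1) / 2" and "pb c t = 1 - (t - c)\<^sup>2"
    and "pd c t = (t - c) * (t - c + 1) / 2" for c t
  define pa' pb' pd' :: "real \<Rightarrow> real \<Rightarrow> real" where "pa' c t = t - c - 1 / 2" and "pb' c t = - 2 * (t - c)"
    and "pd' c t = t - c + 1 / 2" for c t
  note p_defs = pa_def pb_def pd_def pa'_def pb'_def pd'_def
  have derivs:
    "(pa c has_field_derivative pa' c t) (at t)" "(pa' c has_field_derivative 1) (at t)"
    "(pb c has_field_derivative pb' c t) (at t)" "(pb' c has_field_derivative -2) (at t)"
    "(pd c has_field_derivative pd' c t) (at t)" "(pd' c has_field_derivative 1) (at t)" for c t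
    unfolding p_defs[abs_def] by (auto intro!: derivative_eq_intros simp: field_simps)
  have bounds: "\<bar>pa c t\<bar> \<le> 1" "\<bar>pb c t\<bar> \<le> 1" "\<bar>pd c t\<bar> \<le> 1" if "t \<in> {c - 1..c + 1}" for c t
    using quadratic_basis_bounds[OF that] by (simp_all add: p_defs)
  \<comment> \<open>At index 0 only \<open>d\<close> is nonzero: the singular cell contributes to
    node 1 alone, and the value of \<psi> at -1 appearing in \<open>Q 0\<close> is multiplied by
    0.\<close>
  define a where "a k = (if k = 0 then 0 else KP (pa (real (2 * k))) (pa' (real (2 * k))) 1 k)" for k :: nat
  define b where "b k = (if k = 0 then 0 else KP (pb (real (2 * k))) (pb' (real (2 * k))) (-2) k)" for k :: nat
  define d where "d k = (if k = 0 then frac_const \<alpha> / (2 - \<alpha>) else KP (pd (real (2 * k))) (pd' (real (2 * k))) 1 k)" for k :: nat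
  define Q where "Q k = \<psi> (real (2 * k) - 1) * a k + \<psi> (real (2 * k)) * b k + \<psi> (real (2 * k) + 1) * d k" for k
  define P where "P k t = \<psi> (real (2 * k) - 1) * pa (real (2 * k)) t + \<psi> (real (2 * k)) * pb (real (2 * k)) t
    + \<psi> (real (2 * k) + 1) * pd (real (2 * k)) t" for k t
  \<comment> \<open>The breakpoints use truncated subtraction on the naturals, giving 0, 1, 3, 5 and
    so on; cell 0 is thus the unit interval.\<close>
  have P: "((\<lambda>t. P k t * kernel \<alpha> t) has_integral Q k) {real (2 * k - 1)..real (2 * Suc k - 1)}" if "k \<ge> 1" for k
  proof -
    let ?I = "{real (2 * k) - 1..real (2 * k) + 1}" and ?c = "real (2 * k)"
    have le: "0 < ?c - 1" "?c - 1 \<le> ?c + 1"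
      using that by auto
    have "((\<lambda>t. pa ?c t * kernel \<alpha> t) has_integral a k) ?I" "((\<lambda>t. pb ?c t * kernel \<alpha> t) has_integral b k) ?I"
      "((\<lambda>t. pd ?c t * kernel \<alpha> t) has_integral d k) ?I"
      using kernel_has_integral[OF \<alpha> le derivs(1,2)] kernel_has_integral[OF \<alpha> le derivs(3,4)]
        kernel_has_integral[OF \<alpha> le derivs(5,6)] that by (simp_all add: a_def b_def d_def KP_def)
    then have "((\<lambda>t. \<psi> (?c - 1) * (pa ?c t * kernel \<alpha> t) + \<psi> ?c * (pb ?c t * kernel \<alpha> t)
        + \<psi> (?c + 1) * (pd ?c t * kernel \<alpha> t)) has_integral Q k) ?I"
      unfolding Q_def by (intro has_integral_add has_integral_mult_right)
    moreover have "real (2 * k - 1) = ?c - 1" "real (2 * Suc k - 1) = ?c + 1"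
      using that by (auto simp: of_nat_diff)
    ultimately show ?thesis
      by (simp only: P_def distrib_right mult.assoc)
  qed
  \<comment> \<open>The middle basis polynomial vanishes at both cell ends, so no term with
    \<open>deriv (F \<alpha>)\<close> arises.\<close>
  have w_even: "weight_Q \<alpha> h (Suc (2 * n + 1)) = h powr (- \<alpha>) * b (Suc n)" for n
    using \<alpha> by (simp add: weight_Q_def b_def KP_def kernel_primitive_def p_defs deriv_G algebra_simps)
  \<comment> \<open>The terms with \<open>deriv (F \<alpha>)\<close> at the shared node cancel,
    except for \<open>n = 0\<close>, where one remains as the second derivative of
    \<open>G \<alpha>\<close> at 1.\<close>
  have w_odd: "weight_Q \<alpha> h (Suc (2 * n)) = h powr (- \<alpha>) * (d n + a (Suc n))" for n
    using \<alpha> by (cases "n = 0")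
      (simp_all add: weight_Q_def a_def d_def KP_def kernel_primitive_def p_defs deriv_G deriv2_G field_simps)
  let ?T = "\<lambda>n. \<Sum>j<n. \<psi> (real (Suc j)) * weight_Q \<alpha> h (Suc j)"
  have T_odd: "?T (2 * n + 1) = h powr (- \<alpha>) * ((\<Sum>k<Suc n. Q k) + \<psi> (real (2 * n + 1)) * a (Suc n))" for n
  proof (induction n)
    case 0
    then show ?case using w_odd[of 0] by (simp add: Q_def a_def b_def algebra_simps)
  next
    case (Suc n)
    have "?T (2 * Suc n + 1) = ?T (2 * n + 1) + \<psi> (real (2 * Suc n)) * weight_Q \<alpha> h (Suc (2 * n + 1))
        + \<psi> (real (2 * Suc n + 1)) * weight_Q \<alpha> h (Suc (2 * Suc n))"
      by simp
    also have "\<dots> = h powr (- \<alpha>) * ((\<Sum>k<Suc (Suc n). Q k) + \<psi> (real (2 * Suc n + 1)) * a (Suc (Suc n)))"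
      unfolding Suc.IH w_even w_odd by (simp add: Q_def algebra_simps)
    finally show ?case .
  qed
  have T_even: "?T (2 * n + 1 + 1) = ?T (2 * n + 1) + h powr (- \<alpha>) * (\<psi> (real (2 * n + 2)) * b (Suc n))" for n
    using w_even[of n] by simp
  have lim: "filterlim (\<lambda>n. real (2 * Suc n) - 1) at_top sequentially"
    by (rule filterlim_at_top_mono[OF filterlim_real_sequentially]) auto
  have a_lim: "(\<lambda>n. \<psi> (real (2 * n + 1)) * a (Suc n)) \<longlonglongrightarrow> 0"
    using tendsto_kernel_primitive_diff[OF \<alpha> _ lim _ derivs(1,2), of 2 "\<lambda>n. real (2 * Suc n)" "\<lambda>n. \<psi> (real (2 * n + 1))" M]
      bounds(1) \<psi> by (simp add: a_def KP_def)
  have b_lim: "(\<lambda>n. \<psi> (real (2 * n + 2)) * b (Suc n)) \<longlonglongrightarrow> 0"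
    using tendsto_kernel_primitive_diff[OF \<alpha> _ lim _ derivs(3,4), of 2 "\<lambda>n. real (2 * Suc n)" "\<lambda>n. \<psi> (real (2 * n + 2))" M]
      bounds(2) \<psi> by (simp add: b_def KP_def)
  have p_lim: "filterlim (\<lambda>k. real (2 * k - 1)) at_top sequentially"
    by (rule filterlim_compose[OF filterlim_real_sequentially], rule filterlim_at_top_mono[OF filterlim_ident])
       (auto simp: eventually_sequentially intro!: exI[of _ 1])
  obtain s where s: "Q sums s" "\<bar>integral {0..} (\<lambda>t. \<psi> t * kernel \<alpha> t) - s\<bar>
      \<le> \<epsilon>0 * \<bar>frac_const \<alpha>\<bar> / (2 - \<alpha>) + \<epsilon> * \<bar>frac_const \<alpha>\<bar> / \<alpha>"
  proof (rule quadrature_error_series[OF \<alpha> int, of "\<lambda>k. real (2 * k - 1)" Q \<epsilon>0 P \<epsilon>])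
    show "mono (\<lambda>k. real (2 * k - 1))"
      by (auto simp: mono_def)
    show "\<bar>\<psi> t - P k t\<bar> \<le> \<epsilon>" if "1 \<le> k" "t \<in> {real (2 * k - 1)..real (2 * Suc k - 1)}" for k t
      unfolding P_def p_defs by (rule far) (use that in \<open>auto simp: of_nat_diff\<close>)
  qed (use near P p_lim in \<open>auto simp: Q_def a_def b_def d_def\<close>)
  have "(\<lambda>n. \<Sum>k<Suc n. Q k) \<longlonglongrightarrow> s"
    using s(1) unfolding sums_def by (rule LIMSEQ_Suc)
  then have odd: "(\<lambda>n. ?T (2 * n + 1)) \<longlonglongrightarrow> h powr (- \<alpha>) * s"
    unfolding T_odd using a_lim tendsto_mult[OF tendsto_const tendsto_add] by fastforce
  have even: "(\<lambda>n. ?T (2 * n + 1 + 1)) \<longlonglongrightarrow> h powr (- \<alpha>) * s"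
    unfolding T_even using tendsto_add[OF odd tendsto_mult[OF tendsto_const b_lim]] by simp
  \<comment> \<open>The shift by one starts at a single summand, the shortest length covered by
    \<open>T_odd\<close>, and puts odd lengths at even indices.\<close>
  have "(\<lambda>j. \<psi> (real (Suc j)) * weight_Q \<alpha> h (Suc j)) sums (h powr (- \<alpha>) * s)"
    unfolding sums_def using LIMSEQ_even_odd[of "\<lambda>n. ?T (n + 1)", OF odd even] by (rule LIMSEQ_offset)
  with s(2) that show ?thesis by blast
qed

subsection \<open>Interpolation errors\<close>

lemma Taylor_bound:
  fixes u :: "real \<Rightarrow> real"
  assumes diff: "\<And>k x. k < N \<Longrightarrow> (deriv ^^ k) u differentiable (at x)"
    and n: "0 < n" "n \<le> N"
    and M: "\<And>x. \<bar>(deriv ^^ n) u x\<bar> \<le> M"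
  shows "\<bar>u (x + s) - (\<Sum>m<n. (deriv ^^ m) u x / fact m * s ^ m)\<bar> \<le> M / fact n * \<bar>s\<bar> ^ n"
proof (cases "s = 0")
  case True
  then show ?thesis
    using n by (cases n) (simp_all add: sum.lessThan_Suc_shift)
next
  case False
  \<comment> \<open>The Lagrange form of the remainder needs two distinct points, hence the separate
    case \<open>s = 0\<close>; \<open>min\<close> and \<open>max\<close> cover both signs of
    \<open>s\<close>.\<close>
  have "\<exists>t. (if x + s < x then x + s < t \<and> t < x else x < t \<and> t < x + s) \<and>
    u (x + s) = (\<Sum>m<n. (deriv ^^ m) u x / fact m * (x + s - x) ^ m) + (deriv ^^ n) u t / fact n * (x + s - x) ^ n"
  proof (rule Taylor[where a = "min x (x + s)" and b = "max x (x + s)"])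
    show "\<forall>m t. m < n \<and> min x (x + s) \<le> t \<and> t \<le> max x (x + s) \<longrightarrow>
        ((deriv ^^ m) u has_real_derivative (deriv ^^ Suc m) u t) (at t)"
      using diff n by (auto simp: DERIV_deriv_iff_real_differentiable)
  qed (use n False in auto)
  then obtain t where "u (x + s) = (\<Sum>m<n. (deriv ^^ m) u x / fact m * s ^ m) + (deriv ^^ n) u t / fact n * s ^ n"
    by auto
  then show ?thesis
    using M[of t] by (simp add: abs_mult power_abs divide_right_mono mult_right_mono)
qed

text \<open>Only the remainder \<open>R\<close> after subtracting the polynomial matters. The factor
  3 counts its value at \<open>t\<close> and at the two nodes, each multiplied by a weight of
  modulus at most 1.\<close>

lemma interpolation_error_linear:
  fixes f :: "real \<Rightarrow> real"
  assumes f: "\<And>t. t \<in> {k..k + 1} \<Longrightarrow> \<bar>f t - (q0 + q1 * (t - k))\<bar> \<le> K"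
    and t: "t \<in> {k..k + 1}"
  shows "\<bar>f t - (f k * (k + 1 - t) + f (k + 1) * (t - k))\<bar> \<le> 3 * K"
proof -
  define R where "R t = f t - (q0 + q1 * (t - k))" for t
  have R: "\<bar>R t\<bar> \<le> K" if "t \<in> {k..k + 1}" for t
    using f[OF that] by (simp add: R_def)
  have *: "\<bar>R z * c\<bar> \<le> K" if "z \<in> {k..k + 1}" "\<bar>c\<bar> \<le> 1" for z c
    using mult_mono[OF R[OF that(1)] that(2)] order_trans[OF abs_ge_zero R[OF that(1)]] by (simp add: abs_mult)
  have "f t - (f k * (k + 1 - t) + f (k + 1) * (t - k)) = R t - R k * (k + 1 - t) - R (k + 1) * (t - k)"
    by (simp add: R_def algebra_simps)
  then show ?thesis
    using R[OF t] *[of k "k + 1 - t"] *[of "k + 1" "t - k"] t by auto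
qed

text \<open>As in the linear case, now with three nodes, hence the factor 4.\<close>

lemma interpolation_error_quadratic:
  fixes f :: "real \<Rightarrow> real"
  assumes f: "\<And>t. t \<in> {c - 1..c + 1} \<Longrightarrow> \<bar>f t - (q0 + q1 * (t - c) + q2 * (t - c)\<^sup>2)\<bar> \<le> K"
    and t: "t \<in> {c - 1..c + 1}"
  shows "\<bar>f t - (f (c - 1) * ((t - c) * (t - c - 1) / 2) + f c * (1 - (t - c)\<^sup>2)
      + f (c + 1) * ((t - c) * (t - c + 1) / 2))\<bar> \<le> 4 * K"
proof -
  define R where "R t = f t - (q0 + q1 * (t - c) + q2 * (t - c)\<^sup>2)" for t
  have R: "\<bar>R t\<bar> \<le> K" if "t \<in> {c - 1..c + 1}" for t
    using f[OF that] by (simp add: R_def)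
  have *: "\<bar>R z * w\<bar> \<le> K" if "z \<in> {c - 1..c + 1}" "\<bar>w\<bar> \<le> 1" for z w
    using mult_mono[OF R[OF that(1)] that(2)] order_trans[OF abs_ge_zero R[OF that(1)]] by (simp add: abs_mult)
  have eq: "f t - (f (c - 1) * ((t - c) * (t - c - 1) / 2) + f c * (1 - (t - c)\<^sup>2)
      + f (c + 1) * ((t - c) * (t - c + 1) / 2))
    = R t - R (c - 1) * ((t - c) * (t - c - 1) / 2) - R c * (1 - (t - c)\<^sup>2)
      - R (c + 1) * ((t - c) * (t - c + 1) / 2)"
    by (simp add: R_def field_simps power2_eq_square)
  show ?thesis
    unfolding eq using R[OF t]
      *[of "c - 1" "(t - c) * (t - c - 1) / 2"] *[of c "1 - (t - c)\<^sup>2"] *[of "c + 1" "(t - c) * (t - c + 1) / 2"]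
      quadratic_basis_bounds[OF t] by auto
qed

subsection \<open>The fractional Laplacian as an integral over the half line\<close>

definition second_difference :: "(real \<Rightarrow> real) \<Rightarrow> real \<Rightarrow> real \<Rightarrow> real" where
  "second_difference u x y = 2 * u x - u (x + y) - u (x - y)"

text \<open>For nonnegative functions gauge integrability is absolute; Borel measurability then
  permits the return from the completed measure to \<open>lborel\<close>.\<close>

lemma set_integrable_lborel_nonneg:
  fixes f :: "real \<Rightarrow> real"
  assumes "f \<in> borel_measurable borel" "A \<in> sets borel" "f integrable_on A" "\<And>x. x \<in> A \<Longrightarrow> 0 \<le> f x"
  shows "set_integrable lborel A f"
proof -
  have "set_integrable lebesgue A f"
    using assms by (intro nonnegative_absolutely_integrable_1) auto
  moreover have "(\<lambda>x. indicator A x *\<^sub>R f x) \<in> borel_measurable lborel"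
    using assms by measurable
  ultimately show ?thesis
    unfolding set_integrable_def by (simp add: integrable_completion)
qed

lemma set_integrable_powr_tail:
  assumes "0 < \<alpha>" "0 < (a::real)"
  shows "set_integrable lborel {a..} (\<lambda>t. t powr (- \<alpha> - 1))"
  by (rule set_integrable_lborel_nonneg)
     (use has_integral_integrable[OF has_integral_powr_to_inf[of "- \<alpha> - 1" a]] assms in auto)

text \<open>The majorant changes at 1: the quadratic bound uses \<alpha> < 2 near 0, the constant
  bound uses \<alpha> > 0 at infinity.\<close>

lemma set_integrable_powr_weight:
  fixes \<psi> :: "real \<Rightarrow> real"
  assumes \<alpha>: "0 < \<alpha>" "\<alpha> < 2"
    and [measurable]: "\<psi> \<in> borel_measurable borel"
    and near: "\<And>t. \<bar>\<psi> t\<bar> \<le> A * t\<^sup>2" and far: "\<And>t. \<bar>\<psi> t\<bar> \<le> B"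
  shows "set_integrable lborel {0..} (\<lambda>t. \<psi> t * t powr (- \<alpha> - 1))"
proof -
  have "set_integrable lborel {0..1} (\<lambda>t. t powr (1 - \<alpha>))"
    by (rule set_integrable_lborel_nonneg)
       (use has_integral_integrable[OF has_integral_powr_from_0[of "1 - \<alpha>" 1]] \<alpha> in auto)
  then have "set_integrable lborel {0..1} (\<lambda>t. A * t powr (1 - \<alpha>))"
    by simp
  then have 1: "set_integrable lborel {0..1} (\<lambda>t. \<psi> t * t powr (- \<alpha> - 1))"
  proof (rule set_integrable_bound)
    have "norm (\<psi> t * t powr (- \<alpha> - 1)) \<le> norm (A * t powr (1 - \<alpha>))" if "t \<in> {0..1}" for t
    proof (cases "t = 0")
      case False
      then have t: "0 < t" using that by simp
      then have "t\<^sup>2 * t powr (- \<alpha> - 1) = t powr (1 - \<alpha>)"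
        by (simp add: powr_add[symmetric] flip: powr_numeral)
      moreover have "norm (\<psi> t * t powr (- \<alpha> - 1)) \<le> A * t\<^sup>2 * t powr (- \<alpha> - 1)"
        using near[of t] by (simp add: abs_mult mult_right_mono)
      ultimately show ?thesis
        by (simp add: mult.assoc)
    qed simp
    then show "AE t in lborel. t \<in> {0..1} \<longrightarrow> norm (\<psi> t * t powr (- \<alpha> - 1)) \<le> norm (A * t powr (1 - \<alpha>))"
      by simp
  qed (simp add: set_borel_measurable_def)
  have "set_integrable lborel {1..} (\<lambda>t. B * t powr (- \<alpha> - 1))"
    using set_integrable_powr_tail[OF \<alpha>(1), of 1] by simp
  then have 2: "set_integrable lborel {1..} (\<lambda>t. \<psi> t * t powr (- \<alpha> - 1))"
  proof (rule set_integrable_bound)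
    have "norm (\<psi> t * t powr (- \<alpha> - 1)) \<le> norm (B * t powr (- \<alpha> - 1))" for t
      using far[of t] by (simp add: abs_mult mult_right_mono)
    then show "AE t in lborel. t \<in> {1..} \<longrightarrow> norm (\<psi> t * t powr (- \<alpha> - 1)) \<le> norm (B * t powr (- \<alpha> - 1))"
      by simp
  qed (simp add: set_borel_measurable_def)
  have "{0..} = {0..1} \<union> {1::real..}"
    by auto
  then show ?thesis
    using set_integrable_Un[OF 1 2] by simp
qed

lemma tendsto_set_integral_at_right_0:
  fixes g :: "real \<Rightarrow> real"
  assumes g: "set_integrable lborel {0..} g" and "g 0 = 0"
  shows "((\<lambda>\<epsilon>. LINT y:{\<epsilon><..}|lborel. g y) \<longlongrightarrow> (LINT y:{0..}|lborel. g y)) (at_right 0)"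
proof (rule tendsto_at_right_sequentially[of 0 1])
  fix S :: "nat \<Rightarrow> real"
  assume S: "\<And>n. 0 < S n" "decseq S" "S \<longlonglongrightarrow> 0"
  have Un: "(\<Union>n. {S n<..}) = {0<..}"
  proof safe
    fix y :: real assume "0 < y"
    then have "\<forall>\<^sub>F n in sequentially. S n < y"
      using S(3) by (rule order_tendstoD(2)[rotated])
    then show "y \<in> (\<Union>n. {S n<..})"
      by (auto simp: eventually_sequentially)
  qed (use S(1) in \<open>force intro: less_trans\<close>)
  have "(\<lambda>n. LINT y:{S n<..}|lborel. g y) \<longlonglongrightarrow> (LINT y:(\<Union>n. {S n<..})|lborel. g y)"
    by (rule set_integral_cont_up)
       (use S(2) Un in \<open>auto simp: incseq_def decseq_def intro!: set_integrable_subset[OF g] intro: le_less_trans\<close>)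
  moreover have "(LINT y:{0<..}|lborel. g y) = (LINT y:{0..}|lborel. g y)"
    unfolding set_lebesgue_integral_def
    by (rule Bochner_Integration.integral_cong) (use assms(2) in \<open>auto simp: indicator_def less_le\<close>)
  ultimately show "(\<lambda>n. LINT y:{S n<..}|lborel. g y) \<longlonglongrightarrow> (LINT y:{0..}|lborel. g y)"
    by (simp add: Un)
qed simp

text \<open>Before the limit each half of the domain is absolutely integrable because
  \<open>u\<close> is bounded, so reflecting the left half and adding is legitimate.\<close>

lemma truncated_integral_eq:
  fixes u :: "real \<Rightarrow> real"
  assumes \<alpha>: "0 < \<alpha>" and [measurable]: "u \<in> borel_measurable borel" and M: "\<And>x. \<bar>u x\<bar> \<le> M" and \<epsilon>: "0 < \<epsilon>"
  shows "(LINT y:{y. \<epsilon> < \<bar>y\<bar>}|lborel. (u x - u (x - y)) / \<bar>y\<bar> powr (1 + \<alpha>))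
    = (LINT y:{\<epsilon><..}|lborel. second_difference u x y * y powr (- \<alpha> - 1))"
proof -
  let ?f = "\<lambda>y. (u x - u (x - y)) / \<bar>y\<bar> powr (1 + \<alpha>)"
  have pw: "y powr (- \<alpha> - 1) = 1 / y powr (1 + \<alpha>)" for y :: real
  proof -
    have "- \<alpha> - 1 = - (1 + \<alpha>)"
      by simp
    then show ?thesis
      by (simp only: powr_minus_divide)
  qed
  have "set_integrable lborel {\<epsilon><..} (\<lambda>t. t powr (- \<alpha> - 1))"
    by (rule set_integrable_subset[OF set_integrable_powr_tail[OF \<alpha> \<epsilon>]]) auto
  then have dom: "set_integrable lborel {\<epsilon><..} (\<lambda>t. (2 * M) * t powr (- \<alpha> - 1))"
    by simp
  have num: "\<bar>u x - u z\<bar> \<le> \<bar>2 * M\<bar>" for z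
    using M[of x] M[of z] by linarith
  \<comment> \<open>Taking \<open>c = -1\<close> gives the integrand itself and \<open>c = 1\<close>
    its reflection.\<close>
  have side: "set_integrable lborel {\<epsilon><..} (\<lambda>y. (u x - u (x + c * y)) / \<bar>y\<bar> powr (1 + \<alpha>))" for c
    using dom
  proof (rule set_integrable_bound)
    have "norm ((u x - u (x + c * y)) / \<bar>y\<bar> powr (1 + \<alpha>)) \<le> norm (2 * M * y powr (- \<alpha> - 1))"
      if "y \<in> {\<epsilon><..}" for y
    proof -
      have "\<bar>y\<bar> = y"
        using that \<epsilon> by simp
      then show ?thesis
        unfolding pw using divide_right_mono[OF num, of "y powr (1 + \<alpha>)"] by (simp add: abs_mult)
    qed
    then show "AE y in lborel. y \<in> {\<epsilon><..} \<longrightarrow>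
        norm ((u x - u (x + c * y)) / \<bar>y\<bar> powr (1 + \<alpha>)) \<le> norm (2 * M * y powr (- \<alpha> - 1))"
      by simp
  qed (simp add: set_borel_measurable_def)
  have int: "set_integrable lborel {\<epsilon><..} ?f" "set_integrable lborel {\<epsilon><..} (\<lambda>y. ?f (- y))"
    using side[of "-1"] side[of 1] by simp_all
  have "(\<lambda>y. indicator {\<epsilon><..} (0 + - 1 * y) *\<^sub>R ?f (- (0 + - 1 * y))) = (\<lambda>y. indicator {..<-\<epsilon>} y *\<^sub>R ?f y)"
    by (auto simp: fun_eq_iff indicator_def)
  then have int': "set_integrable lborel {..<-\<epsilon>} ?f"
    using lborel_integrable_real_affine[OF int(2)[unfolded set_integrable_def], of "-1" 0]
    by (simp only: set_integrable_def)
  have "{y. \<epsilon> < \<bar>y\<bar>} = {\<epsilon><..} \<union> {..<-\<epsilon>}" "{\<epsilon><..} \<inter> {..<-\<epsilon>} = {}"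
    using \<epsilon> by auto
  then have "(LINT y:{y. \<epsilon> < \<bar>y\<bar>}|lborel. ?f y) = (LINT y:{\<epsilon><..}|lborel. ?f y) + (LINT y:{..<-\<epsilon>}|lborel. ?f y)"
    by (simp only: set_integral_Un[OF _ int(1) int'])
  also have "(LINT y:{..<-\<epsilon>}|lborel. ?f y) = (LINT y:{\<epsilon><..}|lborel. ?f (- y))"
  proof -
    have "{y. - y \<in> {..<-\<epsilon>}} = {\<epsilon><..}"
      by auto
    then show ?thesis
      by (simp only: Equivalence_Lebesgue_Henstock_Integration.set_integral_reflect[of "{..<-\<epsilon>}" ?f])
  qed
  also have "(LINT y:{\<epsilon><..}|lborel. ?f y) + \<dots> = (LINT y:{\<epsilon><..}|lborel. ?f y + ?f (- y))"
    by (rule set_integral_add(2)[OF int, symmetric])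
  also have "\<dots> = (LINT y:{\<epsilon><..}|lborel. second_difference u x y * y powr (- \<alpha> - 1))"
    by (rule set_lebesgue_integral_cong)
       (use \<epsilon> in \<open>auto simp: pw second_difference_def add_divide_distrib diff_divide_distrib\<close>)
  finally show ?thesis .
qed

text \<open>\<open>Lim\<close> says something only if the limit exists. The quadratic bound at 0
  yields convergence of the truncated integrals, hence the value of the principal value.\<close>

lemma frac_laplacian_eq:
  fixes u :: "real \<Rightarrow> real"
  assumes \<alpha>: "0 < \<alpha>" "\<alpha> < 2" and [measurable]: "u \<in> borel_measurable borel" and M: "\<And>x. \<bar>u x\<bar> \<le> M"
    and A: "\<And>y. \<bar>second_difference u x y\<bar> \<le> A * y\<^sup>2"
  shows "set_integrable lborel {0..} (\<lambda>y. second_difference u x y * kernel \<alpha> y)"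
    and "frac_laplacian \<alpha> u x = (LINT y:{0..}|lborel. second_difference u x y * kernel \<alpha> y)"
proof -
  let ?g = "\<lambda>y. second_difference u x y * y powr (- \<alpha> - 1)"
  have "\<bar>second_difference u x y\<bar> \<le> 4 * M" for y
    using M[of x] M[of "x + y"] M[of "x - y"] unfolding second_difference_def by linarith
  then have g: "set_integrable lborel {0..} ?g"
    by (intro set_integrable_powr_weight[OF \<alpha> _ A]) (auto simp: second_difference_def)
  have kernel: "(\<lambda>y. second_difference u x y * kernel \<alpha> y) = (\<lambda>y. frac_const \<alpha> * ?g y)"
    by (simp add: kernel_def fun_eq_iff)
  show "set_integrable lborel {0..} (\<lambda>y. second_difference u x y * kernel \<alpha> y)"
    unfolding kernel using g by (rule set_integrable_mult_right)
  have "((\<lambda>\<epsilon>. LINT y:{y. \<epsilon> < \<bar>y\<bar>}|lborel. (u x - u (x - y)) / \<bar>y\<bar> powr (1 + \<alpha>))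
      \<longlongrightarrow> (LINT y:{0..}|lborel. ?g y)) (at_right 0)"
    by (rule Lim_transform_eventually[OF tendsto_set_integral_at_right_0[OF g]])
       (auto intro!: eventually_at_right_less[THEN eventually_mono] truncated_integral_eq[symmetric] \<alpha> M)
  then show "frac_laplacian \<alpha> u x = (LINT y:{0..}|lborel. second_difference u x y * kernel \<alpha> y)"
    unfolding frac_laplacian_def pv_integral_def kernel by (simp add: tendsto_Lim)
qed

text \<open>The kernel is homogeneous of degree \<open>- \<alpha> - 1\<close> and the substitution
  adds one factor \<open>h\<close>: this is the origin of the prefactor of the weights.\<close>

lemma kernel_integral_scale:
  fixes \<phi> :: "real \<Rightarrow> real"
  assumes h: "0 < h" and int: "set_integrable lborel {0..} (\<lambda>y. \<phi> y * kernel \<alpha> y)"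
  shows "set_integrable lborel {0..} (\<lambda>t. \<phi> (h * t) * kernel \<alpha> t)"
    and "(LINT y:{0..}|lborel. \<phi> y * kernel \<alpha> y)
      = h powr (- \<alpha>) * integral {0..} (\<lambda>t. \<phi> (h * t) * kernel \<alpha> t)"
proof -
  have eq: "indicator {0..} (0 + h * t) *\<^sub>R (\<phi> (0 + h * t) * kernel \<alpha> (0 + h * t))
    = h powr (- \<alpha> - 1) * (indicator {0..} t *\<^sub>R (\<phi> (h * t) * kernel \<alpha> t))" for t
    using h by (auto simp: indicator_def kernel_def powr_mult zero_le_mult_iff)
  show scaled: "set_integrable lborel {0..} (\<lambda>t. \<phi> (h * t) * kernel \<alpha> t)"
    using lborel_integrable_real_affine[OF int[unfolded set_integrable_def], of h 0] h
    unfolding eq by (simp add: set_integrable_def)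
  have "(LINT y:{0..}|lborel. \<phi> y * kernel \<alpha> y) = h * (h powr (- \<alpha> - 1) * (LINT t:{0..}|lborel. \<phi> (h * t) * kernel \<alpha> t))"
    unfolding set_lebesgue_integral_def
    by (subst lborel_integral_real_affine[where c = h and t = 0], use h in simp, subst eq, use h in simp)
  also have "\<dots> = h powr (- \<alpha>) * (LINT t:{0..}|lborel. \<phi> (h * t) * kernel \<alpha> t)"
    using h by (simp add: powr_diff)
  finally show "(LINT y:{0..}|lborel. \<phi> y * kernel \<alpha> y)
      = h powr (- \<alpha>) * integral {0..} (\<lambda>t. \<phi> (h * t) * kernel \<alpha> t)"
    by (simp add: set_borel_integral_eq_integral(2)[OF scaled])
qed

subsection \<open>Errors of the two schemes\<close>

context
  fixes u :: "real \<Rightarrow> real" and M :: real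
  assumes diff: "\<And>k x. k < 4 \<Longrightarrow> (deriv ^^ k) u differentiable (at x)"
    and M: "\<And>k x. k \<le> 4 \<Longrightarrow> \<bar>(deriv ^^ k) u x\<bar> \<le> M"
begin

text \<open>Expansion takes place about both mirror points \<open>x + y\<close> and
  \<open>x - y\<close>, with opposite increments. Offset \<open>y = 0\<close> treats the
  singularity, where odd orders cancel; other offsets treat the remaining cells.\<close>

lemma second_difference_Taylor:
  assumes "0 < n" "n \<le> 4"
  shows "\<bar>second_difference u x (y + s) - (2 * u x - (\<Sum>m<n. (deriv ^^ m) u (x + y) / fact m * s ^ m)
      - (\<Sum>m<n. (deriv ^^ m) u (x - y) / fact m * (- s) ^ m))\<bar> \<le> 2 * (M / fact n * \<bar>s\<bar> ^ n)"
proof -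
  have T: "\<bar>u (z + r) - (\<Sum>m<n. (deriv ^^ m) u z / fact m * r ^ m)\<bar> \<le> M / fact n * \<bar>r\<bar> ^ n" for z r
    by (rule Taylor_bound[OF diff]) (use assms M in auto)
  show ?thesis
    using T[of "x + y" s] T[of "x - y" "- s"] unfolding second_difference_def
    by (simp add: add.assoc diff_diff_eq)
qed

lemma second_difference_square_bound: "\<bar>second_difference u x y\<bar> \<le> M * y\<^sup>2"
  using second_difference_Taylor[of 2 x 0 y] by (simp add: numeral_2_eq_2 power_abs)

lemma second_difference_near_0:
  assumes "\<bar>t\<bar> \<le> 1"
  shows "\<bar>second_difference u x (h * t) - t\<^sup>2 * second_difference u x h\<bar> \<le> M / 6 * h ^ 4 * t\<^sup>2"
proof -
  let ?D = "(deriv ^^ 2) u x"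
  \<comment> \<open>Two remainders \<open>M / fact 4\<close> make \<open>M / 12\<close>; applying
    this at \<open>h * t\<close> and at \<open>h\<close> gives the final \<open>M / 6\<close>, the
    quadratic terms cancelling exactly.\<close>
  have T: "\<bar>second_difference u x s + ?D * s\<^sup>2\<bar> \<le> M / 12 * s ^ 4" for s
  proof -
    have sum4: "(\<Sum>m<4. f m) = f 0 + f 1 + f 2 + f 3" for f :: "nat \<Rightarrow> real"
      by (simp add: eval_nat_numeral)
    have "2 * u x - (\<Sum>m<4. (deriv ^^ m) u (x + 0) / fact m * s ^ m)
        - (\<Sum>m<4. (deriv ^^ m) u (x - 0) / fact m * (- s) ^ m) = - (?D * s\<^sup>2)"
      unfolding sum4 by (simp add: fact_numeral)
    then show ?thesis
      using second_difference_Taylor[of 4 x 0 s] by (simp add: fact_numeral)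
  qed
  have "t\<^sup>2 * t\<^sup>2 \<le> t\<^sup>2 * 1"
    by (rule mult_left_mono) (use assms in \<open>auto simp: abs_square_le_1\<close>)
  then have t4: "t ^ 4 \<le> t\<^sup>2"
    by (simp flip: power_add)
  have M0: "0 \<le> M"
    using M[of 0 0] by simp
  have "\<bar>second_difference u x (h * t) - t\<^sup>2 * second_difference u x h\<bar>
    = \<bar>(second_difference u x (h * t) + ?D * (h * t)\<^sup>2) - t\<^sup>2 * (second_difference u x h + ?D * h\<^sup>2)\<bar>"
    by (simp add: power_mult_distrib algebra_simps)
  also have "\<dots> \<le> M / 12 * (h * t) ^ 4 + t\<^sup>2 * (M / 12 * h ^ 4)"
    using T[of "h * t"] mult_left_mono[OF T[of h] zero_le_power2[of t]]
    by (intro order_trans[OF abs_triangle_ineq4] add_mono) (simp_all add: abs_mult)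
  also have "(h * t) ^ 4 = h ^ 4 * t ^ 4"
    by (rule power_mult_distrib)
  also have "M / 12 * (h ^ 4 * t ^ 4) \<le> M / 12 * (h ^ 4 * t\<^sup>2)"
    using t4 M0 by (intro mult_left_mono) auto
  finally show ?thesis
    by (simp add: algebra_simps)
qed

lemma second_difference_linear_interpolation:
  fixes h t k x :: real
  assumes h: "0 < h" and t: "t \<in> {k..k + 1}"
  defines "\<psi> \<equiv> \<lambda>t. second_difference u x (h * t)"
  shows "\<bar>\<psi> t - (\<psi> k * (k + 1 - t) + \<psi> (k + 1) * (t - k))\<bar> \<le> 3 * (M * h\<^sup>2)"
proof -
  define q0 q1 where "q0 = 2 * u x - u (x + h * k) - u (x - h * k)"
    and "q1 = h * (deriv u (x - h * k) - deriv u (x + h * k))"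
  have M0: "0 \<le> M"
    using M[of 0 0] by simp
  have "\<bar>\<psi> t - (q0 + q1 * (t - k))\<bar> \<le> M * h\<^sup>2" if "t \<in> {k..k + 1}" for t
  proof -
    have "\<bar>\<psi> t - (q0 + q1 * (t - k))\<bar> \<le> M * \<bar>h * (t - k)\<bar> ^ 2"
      using second_difference_Taylor[of 2 x "h * k" "h * (t - k)"]
      by (simp add: numeral_2_eq_2 \<psi>_def q0_def q1_def algebra_simps)
    also have "\<dots> \<le> M * h ^ 2"
      using that h M0 by (intro mult_left_mono power_mono) (auto simp: abs_mult mult_left_le)
    finally show ?thesis .
  qed
  then show ?thesis
    using t by (rule interpolation_error_linear)
qed

lemma second_difference_quadratic_interpolation:
  fixes h t c x :: real
  assumes h: "0 < h" and t: "t \<in> {c - 1..c + 1}"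
  defines "\<psi> \<equiv> \<lambda>t. second_difference u x (h * t)"
  shows "\<bar>\<psi> t - (\<psi> (c - 1) * ((t - c) * (t - c - 1) / 2) + \<psi> c * (1 - (t - c)\<^sup>2)
      + \<psi> (c + 1) * ((t - c) * (t - c + 1) / 2))\<bar> \<le> 4 * (M / 3 * h ^ 3)"
proof -
  \<comment> \<open>These are the Taylor coefficients at \<open>c\<close> of \<psi>; each derivative
    in \<open>t\<close> brings a factor \<open>h\<close>.\<close>
  define q0 q1 q2 where "q0 = 2 * u x - u (x + h * c) - u (x - h * c)"
    and "q1 = h * (deriv u (x - h * c) - deriv u (x + h * c))"
    and "q2 = - h\<^sup>2 / 2 * ((deriv ^^ 2) u (x + h * c) + (deriv ^^ 2) u (x - h * c))"
  have M0: "0 \<le> M"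
    using M[of 0 0] by simp
  have "\<bar>\<psi> t - (q0 + q1 * (t - c) + q2 * (t - c)\<^sup>2)\<bar> \<le> M / 3 * h ^ 3" if "t \<in> {c - 1..c + 1}" for t
  proof -
    define s where "s = t - c"
    have t_eq: "t = c + s" and s: "\<bar>s\<bar> \<le> 1"
      using that by (auto simp: s_def)
    have "\<bar>\<psi> t - (q0 + q1 * s + q2 * s\<^sup>2)\<bar> \<le> M / 3 * \<bar>h * s\<bar> ^ 3"
    proof -
      have sum3: "(\<Sum>m<3. f m) = f 0 + f 1 + f 2" for f :: "nat \<Rightarrow> real"
        by (simp add: eval_nat_numeral)
      have "2 * u x - (\<Sum>m<3. (deriv ^^ m) u (x + h * c) / fact m * (h * s) ^ m)
          - (\<Sum>m<3. (deriv ^^ m) u (x - h * c) / fact m * (- (h * s)) ^ m) = q0 + q1 * s + q2 * s\<^sup>2"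
        unfolding sum3 by (simp add: q0_def q1_def q2_def fact_numeral algebra_simps)
      then show ?thesis
        using second_difference_Taylor[of 3 x "h * c" "h * s"]
        by (simp add: \<psi>_def t_eq fact_numeral distrib_left)
    qed
    also have "\<dots> \<le> M / 3 * h ^ 3"
      using s h M0 by (intro mult_left_mono power_mono) (auto simp: abs_mult mult_left_le)
    finally show ?thesis
      by (simp add: s_def)
  qed
  then show ?thesis
    using t by (rule interpolation_error_quadratic)
qed

lemma scheme_errors:
  assumes \<alpha>: "0 < \<alpha>" "\<alpha> < 2" and h: "0 < h" "h < 1"
  defines "v \<equiv> \<lambda>k. u (of_int k * h)"
  shows "\<bar>frac_laplacian \<alpha> u (of_int i * h) - discrete_frac_laplacian (weight_T \<alpha> h) v i\<bar>
      \<le> M * \<bar>frac_const \<alpha>\<bar> * (1 / (2 - \<alpha>) + 3 / \<alpha>) * h powr (2 - \<alpha>)"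
    and "\<bar>frac_laplacian \<alpha> u (of_int i * h) - discrete_frac_laplacian (weight_Q \<alpha> h) v i\<bar>
      \<le> M * \<bar>frac_const \<alpha>\<bar> * (1 / (2 - \<alpha>) + 3 / \<alpha>) * h powr (3 - \<alpha>)"
proof -
  define x where "x = of_int i * h"
  define \<psi> where "\<psi> t = second_difference u x (h * t)" for t
  define I where "I = integral {0..} (\<lambda>t. \<psi> t * kernel \<alpha> t)"
  have u0: "\<bar>u z\<bar> \<le> M" for z
    using M[of 0] by simp
  then have M0: "0 \<le> M"
    by (rule order_trans[OF abs_ge_zero])
  have "continuous_on UNIV u"
    using diff[of 0] by (simp add: differentiable_imp_continuous_within continuous_on_eq_continuous_at)
  then have "u \<in> borel_measurable borel"
    by (rule borel_measurable_continuous_onI)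
  note L = frac_laplacian_eq[OF \<alpha> this u0 second_difference_square_bound, of x]
  have int: "set_integrable lborel {0..} (\<lambda>t. \<psi> t * kernel \<alpha> t)"
    unfolding \<psi>_def by (rule kernel_integral_scale(1)[OF h(1) L(1)])
  have lap: "frac_laplacian \<alpha> u x = h powr (- \<alpha>) * I"
    unfolding I_def \<psi>_def L(2) by (rule kernel_integral_scale(2)[OF h(1) L(1)])
  \<comment> \<open>At integers \<psi> is the second difference on the grid. Convergence is part of
    the hypothesis because the infinite sum would otherwise be unspecified.\<close>
  have discrete: "discrete_frac_laplacian w v i = s"
    if "(\<lambda>j. \<psi> (real (Suc j)) * w (Suc j)) sums s" for w s
    using sums_unique[OF that]
    by (simp add: discrete_frac_laplacian_def v_def \<psi>_def second_difference_def x_def algebra_simps)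
  have \<psi>0: "\<psi> 0 = 0"
    by (simp add: \<psi>_def second_difference_def)
  have \<psi>_bound: "\<bar>\<psi> t\<bar> \<le> 4 * M" for t
    using u0[of x] u0[of "x + h * t"] u0[of "x - h * t"] unfolding \<psi>_def second_difference_def by linarith
  have near: "\<bar>\<psi> t - t\<^sup>2 * \<psi> 1\<bar> \<le> M / 6 * h ^ 4 * t\<^sup>2" if "t \<in> {0..1}" for t
    using second_difference_near_0[of t x h] that by (simp add: \<psi>_def)
  \<comment> \<open>Both schemes end here, with \<open>n = 2\<close> or \<open>n = 3\<close>. Since
    \<open>h < 1\<close>, the term with \<open>h ^ 4\<close> from the first cell is absorbed into
    \<open>h ^ n\<close>.\<close>
  have rate: "\<bar>frac_laplacian \<alpha> u x - h powr (- \<alpha>) * s\<bar>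
      \<le> M * \<bar>frac_const \<alpha>\<bar> * (1 / (2 - \<alpha>) + 3 / \<alpha>) * h powr (real n - \<alpha>)"
    if s: "\<bar>I - s\<bar> \<le> M / 6 * h ^ 4 * \<bar>frac_const \<alpha>\<bar> / (2 - \<alpha>) + c * (M * h ^ n) * \<bar>frac_const \<alpha>\<bar> / \<alpha>"
      and c: "c \<le> 3" and n: "n \<le> 4" for s c and n :: nat
  proof -
    have "h ^ 4 \<le> h ^ n"
      using h n by (intro power_decreasing) auto
    then have "M / 6 * h ^ 4 * \<bar>frac_const \<alpha>\<bar> / (2 - \<alpha>) \<le> M * h ^ n * \<bar>frac_const \<alpha>\<bar> / (2 - \<alpha>)"
      using M0 \<alpha> h by (intro divide_right_mono mult_right_mono mult_mono) auto
    moreover have "c * (M * h ^ n) * \<bar>frac_const \<alpha>\<bar> / \<alpha> \<le> 3 * (M * h ^ n) * \<bar>frac_const \<alpha>\<bar> / \<alpha>"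
      using M0 \<alpha> h c by (intro divide_right_mono mult_right_mono) auto
    ultimately have "\<bar>I - s\<bar> \<le> M * \<bar>frac_const \<alpha>\<bar> * (1 / (2 - \<alpha>) + 3 / \<alpha>) * h ^ n"
      using s by (simp add: algebra_simps)
    from mult_left_mono[OF this, of "h powr (- \<alpha>)"]
    have "\<bar>h powr (- \<alpha>) * (I - s)\<bar> \<le> M * \<bar>frac_const \<alpha>\<bar> * (1 / (2 - \<alpha>) + 3 / \<alpha>) * (h powr (- \<alpha>) * h ^ n)"
      by (simp add: abs_mult mult.left_commute)
    also have "h powr (- \<alpha>) * h ^ n = h powr (real n - \<alpha>)"
      using h by (simp add: powr_add[symmetric] flip: powr_realpow)
    finally show ?thesis
      by (simp add: lap right_diff_distrib)
  qed
  obtain s where s: "(\<lambda>j. \<psi> (real (Suc j)) * weight_T \<alpha> h (Suc j)) sums (h powr (- \<alpha>) * s)"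
    "\<bar>I - s\<bar> \<le> M / 6 * h ^ 4 * \<bar>frac_const \<alpha>\<bar> / (2 - \<alpha>) + 3 * (M * h\<^sup>2) * \<bar>frac_const \<alpha>\<bar> / \<alpha>"
    unfolding I_def
    by (rule linear_scheme_error[OF \<alpha> int \<psi>0 \<psi>_bound near
        second_difference_linear_interpolation[OF h(1), where x = x, folded \<psi>_def]])
  show "\<bar>frac_laplacian \<alpha> u (of_int i * h) - discrete_frac_laplacian (weight_T \<alpha> h) v i\<bar>
      \<le> M * \<bar>frac_const \<alpha>\<bar> * (1 / (2 - \<alpha>) + 3 / \<alpha>) * h powr (2 - \<alpha>)"
    using rate[OF s(2)] by (simp add: discrete[OF s(1)] x_def)
  obtain s where s: "(\<lambda>j. \<psi> (real (Suc j)) * weight_Q \<alpha> h (Suc j)) sums (h powr (- \<alpha>) * s)"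
    "\<bar>I - s\<bar> \<le> M / 6 * h ^ 4 * \<bar>frac_const \<alpha>\<bar> / (2 - \<alpha>) + 4 * (M / 3 * h ^ 3) * \<bar>frac_const \<alpha>\<bar> / \<alpha>"
    unfolding I_def
    by (rule quadratic_scheme_error[OF \<alpha> int \<psi>_bound near
        second_difference_quadratic_interpolation[OF h(1), where x = x, folded \<psi>_def]])
  show "\<bar>frac_laplacian \<alpha> u (of_int i * h) - discrete_frac_laplacian (weight_Q \<alpha> h) v i\<bar>
      \<le> M * \<bar>frac_const \<alpha>\<bar> * (1 / (2 - \<alpha>) + 3 / \<alpha>) * h powr (3 - \<alpha>)"
    \<comment> \<open>The constant is 4 from interpolation times \<open>1 / 3\<close> from Taylor,
      below the common bound 3.\<close>
    using rate[of s "4 / 3" 3] s(2) by (simp add: discrete[OF s(1)] x_def)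
qed

end

theorem lemma3:
  fixes \<alpha> :: real and u :: "real \<Rightarrow> real"
  assumes "0 < \<alpha>" and "\<alpha> < 2"
    and "\<And>k x. k < 4 \<Longrightarrow> (deriv ^^ k) u differentiable (at x)"
    and "continuous_on UNIV ((deriv ^^ 4) u)"
    and "\<And>k. k \<le> 4 \<Longrightarrow> bounded (range ((deriv ^^ k) u))"
  shows "\<exists>C::real. \<forall>h::real. \<forall>i::int. 0 < h \<and> h < 1 \<longrightarrow>
           \<bar>frac_laplacian \<alpha> u (of_int i * h)
              - discrete_frac_laplacian (weight_T \<alpha> h) (\<lambda>k. u (of_int k * h)) i\<bar>
             \<le> C * h powr (2 - \<alpha>) \<and>
           \<bar>frac_laplacian \<alpha> u (of_int i * h)
              - discrete_frac_laplacian (weight_Q \<alpha> h) (\<lambda>k. u (of_int k * h)) i\<bar>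
             \<le> C * h powr (3 - \<alpha>)"
proof -
  have "bounded (\<Union>k\<le>4. range ((deriv ^^ k) u))"
    using assms(5) by (intro bounded_UN) auto
  then obtain M where "\<And>k x. k \<le> 4 \<Longrightarrow> \<bar>(deriv ^^ k) u x\<bar> \<le> M"
    unfolding bounded_iff by fastforce
  from scheme_errors[OF assms(3) this assms(1,2)] show ?thesis
    by blast
qed

end
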